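(* Let $I\subseteq\mathbb{R}$ be an interval with interior $I^{\circ}$, let $f:I^{\circ}\to\mathbb{R}$ be a differentiable convex function on $I^{\circ}$, and let $a,b\in I^{\circ}$ with $a<b$. Suppose $f,f'\in L[a,b]$. Then for all real $p,q>1$ with $\frac1p+\frac1q=1$, $$\left|\frac{f(a)+f(b)}{2}-\frac{1}{b-a}\int_a^b f(x)\,dx\right|\le \frac{(b-a)^{\frac1p}\,p}{(p+1)^{1+\frac1p}}\left(\int_a^b |f'(x)|^q\,dx\right)^{\frac1q}.$$
   Context: $L[a,b]$ denotes the set of (Lebesgue) integrable real functions on $[a,b]$. *)

theory Defs
  imports "HOL-Analysis.Analysis"
begin

end

theory Submission
  imports Defs
begin

text \<open>
  Let \<open>m = (a + b) / 2\<close>. Integrating the derivative of \<open>(x - m) f(x)\<close> over \<open>[a, b]\<close> shows that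
  the trapezoid error is a first moment of the derivative:
    \<open>(f(a) + f(b)) / 2 - 1/(b - a) \<integral> f = 1/(b - a) \<integral> (x - m) f'(x) dx\<close>
  (lemma \<open>trapezoid_remainder_has_integral\<close>). Hoelder's inequality bounds the right-hand side by
  the \<open>p\<close>-norm of \<open>x - m\<close>, which is explicit, times the \<open>q\<close>-norm of \<open>f'\<close>. The result is the
  desired estimate with the factor \<open>1 / 2\<close> in place of \<open>p / (p + 1)\<close>, and
  \<open>1 / 2 \<le> p / (p + 1)\<close> because \<open>p \<ge> 1\<close>.

  Convexity guarantees that the \<open>q\<close>-norm is finite. This matters formally: the integral of a
  non-integrable function is \<open>0\<close>, so the bound would otherwise be meaningless. The derivative of
  a convex function is monotone, hence bounded on \<open>[a, b]\<close> by its values at the end points, and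
  every positive power of its absolute value is integrable there.
\<close>

section \<open>Hoelder's inequality\<close>

text \<open>
  Normalise both functions to norm one and integrate Young's inequality. A function of norm zero
  cannot be normalised, but it vanishes almost everywhere and makes the left-hand side zero.
\<close>

lemma Hoelder_inequality_integral:
  fixes u v :: "'a \<Rightarrow> real" and p q :: real
  assumes pq: "p > 1" "q > 1" "1 / p + 1 / q = 1"
    and u: "integrable M (\<lambda>x. \<bar>u x\<bar> powr p)"
    and v: "integrable M (\<lambda>x. \<bar>v x\<bar> powr q)"
    and uv: "integrable M (\<lambda>x. u x * v x)"
  shows "(\<integral>x. \<bar>u x * v x\<bar> \<partial>M)
    \<le> (\<integral>x. \<bar>u x\<bar> powr p \<partial>M) powr (1 / p) * (\<integral>x. \<bar>v x\<bar> powr q \<partial>M) powr (1 / q)"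
proof -
  define U where "U = (\<integral>x. \<bar>u x\<bar> powr p \<partial>M)"
  define V where "V = (\<integral>x. \<bar>v x\<bar> powr q \<partial>M)"
  have nonneg: "U \<ge> 0" "V \<ge> 0"
    by (simp_all add: U_def V_def)
  show ?thesis
  proof (cases "U = 0 \<or> V = 0")
    case True
    then have "(AE x in M. \<bar>u x\<bar> powr p = 0) \<or> (AE x in M. \<bar>v x\<bar> powr q = 0)"
      using integral_nonneg_eq_0_iff_AE[OF u] integral_nonneg_eq_0_iff_AE[OF v]
      by (auto simp: U_def V_def)
    then have "AE x in M. \<bar>u x * v x\<bar> = 0"
      by (elim disjE) (auto elim: eventually_mono)
    then have "(\<integral>x. \<bar>u x * v x\<bar> \<partial>M) = 0"
      by (rule integral_eq_zero_AE)
    then show ?thesis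
      by simp
  next
    case False
    with nonneg have pos: "U > 0" "V > 0" by auto
    define A where "A = U powr (1 / p)"
    define B where "B = V powr (1 / q)"
    have AB: "A > 0" "B > 0" "A powr p = U" "B powr q = V"
      using pos pq by (auto simp: A_def B_def powr_powr)
    have "\<bar>u x * v x\<bar> \<le> A * B * (\<bar>u x\<bar> powr p / (p * U) + \<bar>v x\<bar> powr q / (q * V))" for x
    proof -
      have "(\<bar>u x\<bar> / A) * (\<bar>v x\<bar> / B) \<le> (\<bar>u x\<bar> / A) powr p / p + (\<bar>v x\<bar> / B) powr q / q"
        using AB pq by (intro Youngs_inequality) auto
      also have "\<dots> = \<bar>u x\<bar> powr p / (p * U) + \<bar>v x\<bar> powr q / (q * V)"
        using AB by (simp add: powr_divide mult.commute)
      finally have "A * B * ((\<bar>u x\<bar> / A) * (\<bar>v x\<bar> / B))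
          \<le> A * B * (\<bar>u x\<bar> powr p / (p * U) + \<bar>v x\<bar> powr q / (q * V))"
        using AB by (intro mult_left_mono) auto
      then show ?thesis
        using AB by (simp add: abs_mult)
    qed
    then have "(\<integral>x. \<bar>u x * v x\<bar> \<partial>M)
        \<le> (\<integral>x. A * B * (\<bar>u x\<bar> powr p / (p * U) + \<bar>v x\<bar> powr q / (q * V)) \<partial>M)"
      using u v uv by (intro integral_mono) auto
    also have "\<dots> = A * B * (U / (p * U) + V / (q * V))"
      using u v by (simp add: U_def V_def)
    also have "\<dots> = A * B"
      using pos pq by simp
    finally show ?thesis
      by (simp add: A_def B_def U_def V_def)
  qed
qed

section \<open>The trapezoid error as a moment of the derivative\<close>

lemma trapezoid_remainder_has_integral:
  fixes f f' :: "real \<Rightarrow> real" and a b :: real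
  assumes "a \<le> b"
    and f': "\<And>x. x \<in> {a..b} \<Longrightarrow> (f has_real_derivative f' x) (at x within {a..b})"
  shows "((\<lambda>x. (x - (a + b) / 2) * f' x) has_integral
           (b - a) * ((f a + f b) / 2) - integral {a..b} f) {a..b}"
proof -
  let ?m = "(a + b) / 2"
  have "continuous_on {a..b} f"
    using f' by (meson DERIV_continuous continuous_on_eq_continuous_within)
  then have f: "(f has_integral integral {a..b} f) {a..b}"
    by (intro integrable_integral integrable_continuous_real)
  have "((\<lambda>x. f x + (x - ?m) * f' x) has_integral ((b - ?m) * f b - (a - ?m) * f a)) {a..b}"
  proof (rule fundamental_theorem_of_calculus[OF \<open>a \<le> b\<close>])
    fix x assume "x \<in> {a..b}"
    then have "((\<lambda>x. (x - ?m) * f x) has_real_derivative f x + (x - ?m) * f' x)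
        (at x within {a..b})"
      by (auto intro!: derivative_eq_intros f')
    then show "((\<lambda>x. (x - ?m) * f x) has_vector_derivative f x + (x - ?m) * f' x)
        (at x within {a..b})"
      by (simp add: has_real_derivative_iff_has_vector_derivative)
  qed
  moreover have "(b - ?m) * f b - (a - ?m) * f a = (b - a) * ((f a + f b) / 2)"
    by (simp add: field_simps)
  ultimately have "((\<lambda>x. f x + (x - ?m) * f' x) has_integral (b - a) * ((f a + f b) / 2)) {a..b}"
    by simp
  from has_integral_diff[OF this f] show ?thesis
    by simp
qed

text \<open>
  The power of the weight's norm needed in Hoelder's inequality. The two halves of the interval
  contribute equally, and on each of them the absolute value resolves to a shifted power function.
\<close>

lemma has_integral_abs_diff_midpoint_powr:
  fixes a b p :: real
  assumes "a \<le> b" "p > 0"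
  shows "((\<lambda>x. \<bar>x - (a + b) / 2\<bar> powr p) has_integral
           2 * (((b - a) / 2) powr (p + 1) / (p + 1))) {a..b}"
proof -
  define m where "m = (a + b) / 2"
  have m: "a \<le> m" "m \<le> b" "b - m = (b - a) / 2" "m - a = (b - a) / 2"
    using assms by (auto simp: m_def field_simps)
  have "((\<lambda>x. \<bar>x - m\<bar> powr p) has_integral
      - ((m - m) powr (p + 1) / (p + 1)) - - ((m - a) powr (p + 1) / (p + 1))) {a..m}"
  proof (rule fundamental_theorem_of_calculus_interior[OF \<open>a \<le> m\<close>])
    show "continuous_on {a..m} (\<lambda>x. - ((m - x) powr (p + 1) / (p + 1)))"
      using assms by (intro continuous_intros continuous_on_powr') auto
    fix x assume "x \<in> {a<..<m}"
    then have "((\<lambda>x. - ((m - x) powr (p + 1) / (p + 1))) has_real_derivative \<bar>x - m\<bar> powr p) (at x)"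
      using assms by (auto intro!: derivative_eq_intros simp: add_eq_0_iff)
    then show "((\<lambda>x. - ((m - x) powr (p + 1) / (p + 1))) has_vector_derivative \<bar>x - m\<bar> powr p) (at x)"
      by (simp add: has_real_derivative_iff_has_vector_derivative)
  qed
  moreover have "((\<lambda>x. \<bar>x - m\<bar> powr p) has_integral
      (b - m) powr (p + 1) / (p + 1) - (m - m) powr (p + 1) / (p + 1)) {m..b}"
  proof (rule fundamental_theorem_of_calculus_interior[OF \<open>m \<le> b\<close>])
    show "continuous_on {m..b} (\<lambda>x. (x - m) powr (p + 1) / (p + 1))"
      using assms by (intro continuous_intros continuous_on_powr') auto
    fix x assume "x \<in> {m<..<b}"
    then have "((\<lambda>x. (x - m) powr (p + 1) / (p + 1)) has_real_derivative \<bar>x - m\<bar> powr p) (at x)"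
      using assms by (auto intro!: derivative_eq_intros simp: add_eq_0_iff)
    then show "((\<lambda>x. (x - m) powr (p + 1) / (p + 1)) has_vector_derivative \<bar>x - m\<bar> powr p) (at x)"
      by (simp add: has_real_derivative_iff_has_vector_derivative)
  qed
  ultimately have "((\<lambda>x. \<bar>x - m\<bar> powr p) has_integral
      (- ((m - m) powr (p + 1) / (p + 1)) - - ((m - a) powr (p + 1) / (p + 1))) +
      ((b - m) powr (p + 1) / (p + 1) - (m - m) powr (p + 1) / (p + 1))) {a..b}"
    by (rule has_integral_combine[OF m(1,2)])
  moreover have "(- ((m - m) powr (p + 1) / (p + 1)) - - ((m - a) powr (p + 1) / (p + 1))) +
      ((b - m) powr (p + 1) / (p + 1) - (m - m) powr (p + 1) / (p + 1))
      = 2 * (((b - a) / 2) powr (p + 1) / (p + 1))"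
    unfolding m(3,4) by simp
  ultimately show ?thesis
    unfolding m_def by (simp only:)
qed

text \<open>
  The constant \<open>1 / 2\<close> is what Hoelder's inequality yields; boundedness of \<open>f'\<close> stands in for
  membership in all the \<open>L\<^sup>q\<close> spaces at once.
\<close>

lemma trapezoid_error_le_derivative_norm:
  fixes f f' :: "real \<Rightarrow> real" and a b p q K :: real
  assumes "a < b"
    and pq: "p > 1" "q > 1" "1 / p + 1 / q = 1"
    and f': "\<And>x. x \<in> {a..b} \<Longrightarrow> (f has_real_derivative f' x) (at x within {a..b})"
    and meas: "f' \<in> borel_measurable (lebesgue_on {a..b})"
    and K: "\<And>x. x \<in> {a..b} \<Longrightarrow> \<bar>f' x\<bar> \<le> K"
  shows "\<bar>(f a + f b) / 2 - 1 / (b - a) * integral {a..b} f\<bar>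
    \<le> (b - a) powr (1 / p) / (2 * (p + 1) powr (1 / p))
       * (\<integral>x. \<bar>f' x\<bar> powr q \<partial>lebesgue_on {a..b}) powr (1 / q)"
proof -
  define m where "m = (a + b) / 2"
  define h where "h = b - a"
  let ?M = "lebesgue_on {a..b}"
  define N where "N = (\<integral>x. \<bar>f' x\<bar> powr q \<partial>?M) powr (1 / q)"
  have h: "h > 0" using \<open>a < b\<close> by (simp add: h_def)
  have bounded_integrable: "integrable ?M g"
    if "g \<in> borel_measurable ?M" "\<And>x. x \<in> {a..b} \<Longrightarrow> \<bar>g x\<bar> \<le> C" for g :: "real \<Rightarrow> real" and C
  proof (rule finite_measure.integrable_const_bound[where B = C])
    show "finite_measure ?M"
      by (simp add: finite_measure_lebesgue_on)
  qed (use that in auto)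
  have weight_meas: "(\<lambda>x. x - m) \<in> borel_measurable ?M"
    by (intro continuous_imp_measurable_on_sets_lebesgue continuous_intros) auto
  have weight_bound: "\<bar>x - m\<bar> \<le> h" if "x \<in> {a..b}" for x
    using that by (auto simp: m_def h_def field_simps abs_if)
  have int_weight: "integrable ?M (\<lambda>x. \<bar>x - m\<bar> powr p)"
  proof (rule bounded_integrable)
    show "(\<lambda>x. \<bar>x - m\<bar> powr p) \<in> borel_measurable ?M"
      using weight_meas by measurable
    show "\<bar>\<bar>x - m\<bar> powr p\<bar> \<le> h powr p" if "x \<in> {a..b}" for x
      using weight_bound[OF that] pq by (simp add: powr_mono2)
  qed
  have int_deriv: "integrable ?M (\<lambda>x. \<bar>f' x\<bar> powr q)"
  proof (rule bounded_integrable)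
    show "(\<lambda>x. \<bar>f' x\<bar> powr q) \<in> borel_measurable ?M"
      using meas by measurable
    show "\<bar>\<bar>f' x\<bar> powr q\<bar> \<le> K powr q" if "x \<in> {a..b}" for x
      using K[OF that] pq by (simp add: powr_mono2)
  qed
  have int_prod: "integrable ?M (\<lambda>x. (x - m) * f' x)"
  proof (rule bounded_integrable)
    show "(\<lambda>x. (x - m) * f' x) \<in> borel_measurable ?M"
      using weight_meas meas by measurable
    show "\<bar>(x - m) * f' x\<bar> \<le> h * K" if "x \<in> {a..b}" for x
      unfolding abs_mult using weight_bound[OF that] K[OF that] h by (intro mult_mono) auto
  qed
  have "h * ((f a + f b) / 2 - 1 / h * integral {a..b} f)
      = h * ((f a + f b) / 2) - integral {a..b} f"
    using h by (simp add: field_simps)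
  also have "\<dots> = (\<integral>x. (x - m) * f' x \<partial>?M)"
    using trapezoid_remainder_has_integral[of a b f f'] f' \<open>a < b\<close>
      has_integral_integral_lebesgue_on[OF int_prod]
    by (auto simp: m_def h_def intro: has_integral_unique)
  finally have "h * \<bar>(f a + f b) / 2 - 1 / h * integral {a..b} f\<bar> = \<bar>\<integral>x. (x - m) * f' x \<partial>?M\<bar>"
    using h by (metis abs_mult abs_of_pos)
  also have "\<dots> \<le> (\<integral>x. \<bar>(x - m) * f' x\<bar> \<partial>?M)"
    by (rule integral_abs_bound)
  also have "\<dots> \<le> (\<integral>x. \<bar>x - m\<bar> powr p \<partial>?M) powr (1 / p) * N"
    unfolding N_def by (rule Hoelder_inequality_integral[OF pq int_weight int_deriv int_prod])
  also have "(\<integral>x. \<bar>x - m\<bar> powr p \<partial>?M) = 2 * ((h / 2) powr (p + 1) / (p + 1))"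
    using has_integral_abs_diff_midpoint_powr[of a b p] \<open>a < b\<close> pq
      has_integral_integral_lebesgue_on[OF int_weight]
    by (auto simp: m_def h_def intro: has_integral_unique)
  also have "\<dots> = h * (h / 2) powr p / (p + 1)"
  proof -
    have "(h / 2) powr (p + 1) = (h / 2) powr p * (h / 2)"
      using h by (simp add: powr_add)
    then show ?thesis
      by (simp add: mult.commute del: distrib_left_numeral)
  qed
  also have "\<dots> powr (1 / p) = h powr (1 / p) * (h / 2) / (p + 1) powr (1 / p)"
    using h pq by (simp add: powr_mult powr_divide powr_powr)
  finally have "h * \<bar>(f a + f b) / 2 - 1 / h * integral {a..b} f\<bar>
      \<le> h * (h powr (1 / p) / (2 * (p + 1) powr (1 / p)) * N)"
    by (simp add: field_simps)
  from this[unfolded mult_le_cancel_left_pos[OF h]] show ?thesis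
    unfolding h_def N_def .
qed

section \<open>The derivative of a convex function\<close>

text \<open>
  For \<open>x < y\<close>, the tangent at \<open>x\<close> lies below the chord from \<open>x\<close> to \<open>y\<close>, and so does the tangent
  at \<open>y\<close>; hence the slope of the chord separates the two derivatives.
\<close>

lemma convex_on_derivative_mono:
  fixes f f' :: "real \<Rightarrow> real"
  assumes f: "convex_on A f" and A: "connected A" "x \<in> interior A" "y \<in> interior A"
    and f': "(f has_real_derivative f' x) (at x within A)"
      "(f has_real_derivative f' y) (at y within A)"
    and "x \<le> y"
  shows "f' x \<le> f' y"
proof (cases "x = y")
  case False
  with \<open>x \<le> y\<close> have "x < y" by simp
  have "x \<in> A" "y \<in> A"
    using A interior_subset by blast+
  then have "f y - f x \<ge> f' x * (y - x)" "f x - f y \<ge> f' y * (x - y)"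
    using convex_on_imp_above_tangent[OF f A(1)] A f' by blast+
  then have "f' x * (y - x) \<le> f' y * (y - x)"
    by (simp add: algebra_simps)
  with \<open>x < y\<close> show ?thesis
    by simp
qed simp

section \<open>The trapezoid inequality for convex functions\<close>

theorem theorem5:
  fixes I :: "real set" and f :: "real \<Rightarrow> real" and a b :: real
  assumes "is_interval I"
    and "f differentiable_on interior I"
    and "convex_on (interior I) f"
    and "a \<in> interior I" and "b \<in> interior I" and "a < b"
    and "set_integrable lebesgue {a..b} f"
    and "set_integrable lebesgue {a..b} (deriv f)"
  shows "\<forall>p q :: real. p > 1 \<longrightarrow> q > 1 \<longrightarrow> 1 / p + 1 / q = 1 \<longrightarrow>
    \<bar>(f a + f b) / 2 - 1 / (b - a) * (LINT x:{a..b}|lebesgue. f x)\<bar>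
      \<le> (b - a) powr (1 / p) * p / (p + 1) powr (1 + 1 / p)
         * (LINT x:{a..b}|lebesgue. \<bar>deriv f x\<bar> powr q) powr (1 / q)"
proof (intro allI impI)
  fix p q :: real
  assume pq: "p > 1" "q > 1" "1 / p + 1 / q = 1"
  have "is_interval (interior I)"
    using assms(1) by (simp add: is_interval_convex_1)
  then have conn: "connected (interior I)"
    by (simp only: is_interval_connected_1)
  then have sub: "{a..b} \<subseteq> interior I"
    using assms(4,5) by (rule connected_contains_Icc)
  have deriv: "(f has_real_derivative deriv f x) (at x)" if "x \<in> interior I" for x
    using that assms(2)
    by (simp add: DERIV_deriv_iff_real_differentiable differentiable_on_eq_differentiable_at)
  have mono: "deriv f x \<le> deriv f y" if "x \<in> {a..b}" "y \<in> {a..b}" "x \<le> y" for x y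
  proof (rule convex_on_derivative_mono[where f' = "deriv f", OF assms(3) conn])
    have "x \<in> interior I" "y \<in> interior I"
      using that sub by blast+
    then show "x \<in> interior (interior I)" "y \<in> interior (interior I)"
      "(f has_real_derivative deriv f x) (at x within interior I)"
      "(f has_real_derivative deriv f y) (at y within interior I)"
      by (simp_all add: deriv has_field_derivative_at_within)
  qed (fact \<open>x \<le> y\<close>)
  have error: "\<bar>(f a + f b) / 2 - 1 / (b - a) * integral {a..b} f\<bar>
    \<le> (b - a) powr (1 / p) / (2 * (p + 1) powr (1 / p))
       * (\<integral>x. \<bar>deriv f x\<bar> powr q \<partial>lebesgue_on {a..b}) powr (1 / q)"
  proof (rule trapezoid_error_le_derivative_norm[OF \<open>a < b\<close> pq])
    show "(f has_real_derivative deriv f x) (at x within {a..b})" if "x \<in> {a..b}" for x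
      using that sub by (blast intro: deriv has_field_derivative_at_within)
    show "deriv f \<in> borel_measurable (lebesgue_on {a..b})"
      using assms(8) by (intro absolutely_integrable_imp_borel_measurable) auto
    show "\<bar>deriv f x\<bar> \<le> \<bar>deriv f a\<bar> + \<bar>deriv f b\<bar>" if "x \<in> {a..b}" for x
      using mono[of a x] mono[of x b] that by auto
  qed
  have "(1 :: real) / 2 \<le> p / (p + 1)"
    using pq by (simp add: field_simps)
  then have "(b - a) powr (1 / p) / (p + 1) powr (1 / p) * (1 / 2)
      \<le> (b - a) powr (1 / p) / (p + 1) powr (1 / p) * (p / (p + 1))"
    by (intro mult_left_mono) auto
  also have "\<dots> = (b - a) powr (1 / p) * p / (p + 1) powr (1 + 1 / p)"
    using pq by (simp add: powr_add)
  finally have const: "(b - a) powr (1 / p) / (2 * (p + 1) powr (1 / p))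
      \<le> (b - a) powr (1 / p) * p / (p + 1) powr (1 + 1 / p)"
    by (simp add: mult.commute)
  have "(LINT x:{a..b}|lebesgue. f x) = integral {a..b} f"
    using assms(7) by (rule set_lebesgue_integral_eq_integral(2))
  moreover have "(LINT x:{a..b}|lebesgue. \<bar>deriv f x\<bar> powr q)
      = (\<integral>x. \<bar>deriv f x\<bar> powr q \<partial>lebesgue_on {a..b})"
    unfolding set_lebesgue_integral_def by (subst integral_restrict_space) auto
  ultimately show "\<bar>(f a + f b) / 2 - 1 / (b - a) * (LINT x:{a..b}|lebesgue. f x)\<bar>
      \<le> (b - a) powr (1 / p) * p / (p + 1) powr (1 + 1 / p)
         * (LINT x:{a..b}|lebesgue. \<bar>deriv f x\<bar> powr q) powr (1 / q)"
    using order_trans[OF error mult_right_mono[OF const]] by simp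
qed

end
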